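(* Let $p$ be a prime with $p \equiv 3 \pmod 4$ and let $k \geq 1$. Then, viewing elements of $\mathbb{Z}_{p^k}$ as residues of integers, $$S_{p^k} = \{0\} \cup \{ t \cdot p^{2s} \bmod p^k : s \in \mathbb{N},\ t \not\equiv 0 \pmod p\}$$ and $$N_{p^k} = \{ t \cdot p^{2s+1} \bmod p^k : s \in \mathbb{N},\ t \not\equiv 0 \pmod p\}.$$
   Context: For a positive integer $n$, $\mathbb{Z}_n$ denotes the ring of integers modulo $n$. Define $S_n := \{ m \in \mathbb{Z}_n : m = x^2 + y^2 \text{ for some } x, y \in \mathbb{Z}_n\}$ (zero is allowed as one or both squares) and $N_n := \mathbb{Z}_n \setminus S_n$. Here $\mathbb{N}$ includes $0$.
   Formalization: In the formula for N_{p^k} the exponent is restricted to 2s+1 < k; with s unrestricted the right-hand side would contain 0 = 0^2+0^2, which lies in S_{p^k} (e.g. N_3 is empty but the stated set is {0}). *)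

theory Defs
  imports "HOL-Number_Theory.Residues"
begin

definition sums_two_squares_mod :: "nat \<Rightarrow> int set" where
  "sums_two_squares_mod n =
    (let R = residue_ring (int n) in
      {m \<in> carrier R. \<exists>x\<in>carrier R. \<exists>y\<in>carrier R.
         m = x [^]\<^bsub>R\<^esub> (2::nat) \<oplus>\<^bsub>R\<^esub> y [^]\<^bsub>R\<^esub> (2::nat)})"

definition non_sums_two_squares_mod :: "nat \<Rightarrow> int set" where
  "non_sums_two_squares_mod n = carrier (residue_ring (int n)) - sums_two_squares_mod n"

end

theory Submission
  imports Defs
begin

text \<open>
  Write a nonzero residue as \<open>t * p ^ j\<close> with \<open>p\<close> not dividing \<open>t\<close> and \<open>j < k\<close>.
  The unit \<open>t\<close> is always a sum of two squares: modulo \<open>p\<close> because the \<open>(p + 1) / 2\<close> squares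
  and the \<open>(p + 1) / 2\<close> values \<open>t - y\<^sup>2\<close> must overlap, and modulo \<open>p ^ k\<close> by Hensel lifting.
  Hence even \<open>j\<close> gives sums of two squares. Since \<open>-1\<close> is not a square modulo \<open>p\<close>,
  \<open>p\<close> dividing \<open>x\<^sup>2 + y\<^sup>2\<close> forces \<open>p\<close> to divide \<open>x\<close> and \<open>y\<close>, so by descent \<open>p\<close> divides an integer
  sum of two squares to an even power, which excludes odd \<open>j\<close>.
\<close>

text \<open>Passes from ring operations to integer congruences, so that everything later happens in
  the integers. The witnesses may be arbitrary integers because reducing them modulo
  \<open>n\<close> puts them in the carrier; \<open>n > 1\<close> is what the locale
  \<open>residues\<close> requires.\<close>

lemma mem_sums_two_squares_mod_iff:
  assumes "n > 1"
  shows "m \<in> sums_two_squares_mod n \<longleftrightarrow>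
    0 \<le> m \<and> m < int n \<and> (\<exists>x y. [m = x\<^sup>2 + y\<^sup>2] (mod int n))"
proof -
  interpret residues "int n" "residue_ring (int n)"
    using assms by unfold_locales simp_all
  have sq: "x [^]\<^bsub>residue_ring (int n)\<^esub> (2::nat) = x\<^sup>2 mod int n" if "0 \<le> x" "x < int n" for x
    using that pow_cong[of x 2] by simp
  have car: "x \<in> carrier (residue_ring (int n)) \<longleftrightarrow> 0 \<le> x \<and> x < int n" for x
    by (auto simp: res_carrier_eq)
  show ?thesis (is "?L \<longleftrightarrow> ?R")
  proof
    assume ?L
    then show ?R
      unfolding sums_two_squares_mod_def Let_def
      by (auto simp: car sq res_add_eq cong_def mod_simps)
  next
    assume ?R
    then obtain x y where m: "0 \<le> m" "m < int n" and "[m = x\<^sup>2 + y\<^sup>2] (mod int n)"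
      by blast
    then have "m = ((x mod int n)\<^sup>2 mod int n + (y mod int n)\<^sup>2 mod int n) mod int n"
      by (simp add: cong_def mod_simps)
    moreover have "0 \<le> z mod int n \<and> z mod int n < int n" for z
      using assms by simp
    ultimately show ?L
      unfolding sums_two_squares_mod_def Let_def using m
      by (intro CollectI conjI bexI[of _ "x mod int n"] bexI[of _ "y mod int n"])
        (simp_all add: car sq res_add_eq)
  qed
qed

section \<open>Units are sums of two squares modulo prime powers\<close>

text \<open>Equal squares make \<open>p\<close> divide \<open>(x - y) * (x + y)\<close>, and on the
  half range both factors are smaller than \<open>p\<close> in absolute value.\<close>

lemma inj_on_square_mod_prime:
  fixes p :: nat
  assumes "prime p" "odd p"
  shows "inj_on (\<lambda>x. x\<^sup>2 mod int p) {0..(int p - 1) div 2}"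
proof (rule inj_onI)
  fix x y assume x: "x \<in> {0..(int p - 1) div 2}" and y: "y \<in> {0..(int p - 1) div 2}"
    and eq: "x\<^sup>2 mod int p = y\<^sup>2 mod int p"
  have p0: "int p > 0" using assms prime_gt_0_nat by simp
  have "int p dvd x\<^sup>2 - y\<^sup>2" using eq by (simp add: mod_eq_dvd_iff)
  then have "int p dvd (x - y) * (x + y)" by (simp add: power2_eq_square algebra_simps)
  then consider "int p dvd x - y" | "int p dvd x + y"
    using assms by (auto simp: prime_dvd_mult_iff)
  then show "x = y"
  proof cases
    case 1
    have "\<bar>x - y\<bar> < int p" using x y p0 by auto
    with 1 show ?thesis using zdvd_not_zless[of "\<bar>x - y\<bar>" "int p"] by fastforce
  next
    case 2
    have "x + y < int p" "x + y \<ge> 0" using x y p0 by auto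
    with 2 have "x + y = 0" using zdvd_not_zless[of "x + y" "int p"] by fastforce
    with x y show ?thesis by auto
  qed
qed

lemma sum_two_squares_mod_prime:
  fixes p :: nat and t :: int
  assumes "prime p" "odd p"
  shows "\<exists>x y. [x\<^sup>2 + y\<^sup>2 = t] (mod int p)"
proof -
  let ?H = "{0..(int p - 1) div 2}"
  let ?A = "(\<lambda>x. x\<^sup>2 mod int p) ` ?H"
  let ?B = "(\<lambda>y. (t - y\<^sup>2) mod int p) ` ?H"
  have p0: "int p > 0" using assms prime_gt_0_nat by simp
  have sq: "inj_on (\<lambda>x. x\<^sup>2 mod int p) ?H"
    by (rule inj_on_square_mod_prime[OF assms])
  have "x\<^sup>2 mod int p = y\<^sup>2 mod int p" if "(t - x\<^sup>2) mod int p = (t - y\<^sup>2) mod int p" for x y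
  proof -
    have "int p dvd y\<^sup>2 - x\<^sup>2" using that by (simp add: mod_eq_dvd_iff)
    then have "int p dvd x\<^sup>2 - y\<^sup>2" by (subst dvd_diff_commute)
    then show ?thesis by (simp add: mod_eq_dvd_iff)
  qed
  then have inj: "inj_on (\<lambda>y. (t - y\<^sup>2) mod int p) ?H"
    using sq unfolding inj_on_def by blast
  have "?A \<inter> ?B \<noteq> {}"
  proof
    assume disj: "?A \<inter> ?B = {}"
    have "card (?A \<union> ?B) = card ?H + card ?H"
      using disj by (simp add: card_Un_disjoint card_image[OF sq] card_image[OF inj])
    moreover have "card (?A \<union> ?B) \<le> card {0..<int p}"
      using p0 by (intro card_mono) auto
    \<comment> \<open>Since \<open>?H\<close> contains 0, it has \<open>(p + 1) div 2\<close>
      elements; two disjoint images would need one residue too many.\<close>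
    moreover have "int (card ?H + card ?H) = int p + 1"
      using assms(2) p0 by (auto elim!: oddE)
    ultimately have "int p + 1 \<le> int (card {0..<int p})"
      by (metis of_nat_le_iff)
    then show False by simp
  qed
  then obtain x y where "x\<^sup>2 mod int p = (t - y\<^sup>2) mod int p" by auto
  then have "[x\<^sup>2 + y\<^sup>2 = t] (mod int p)"
    by (simp add: cong_iff_dvd_diff mod_eq_dvd_iff algebra_simps)
  then show ?thesis by blast
qed

text \<open>Newton step in \<open>x\<close> alone with \<open>y\<close> fixed: the derivative
  \<open>2 * x\<close> is invertible modulo \<open>p\<close>.\<close>

lemma hensel_step_sum_two_squares:
  fixes p k :: nat and t x y :: int
  assumes "prime p" "odd p" "k \<ge> 1" "\<not> int p dvd x"
    and "[x\<^sup>2 + y\<^sup>2 = t] (mod int p ^ k)"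
  shows "\<exists>x'. [x'\<^sup>2 + y\<^sup>2 = t] (mod int p ^ Suc k)"
proof -
  obtain c where c: "x\<^sup>2 + y\<^sup>2 - t = int p ^ k * c"
    using assms(5) by (auto simp: cong_iff_dvd_diff)
  have "\<not> int p dvd 2"
  proof
    assume "int p dvd 2"
    then have "p dvd 2" by (metis of_nat_dvd_iff of_nat_numeral)
    then show False using assms(1,2) primes_dvd_imp_eq two_is_prime_nat by blast
  qed
  then have "\<not> int p dvd 2 * x"
    using assms(1,4) by (simp add: prime_dvd_mult_iff)
  then have "coprime (2 * x) (int p)"
    using assms(1) by (metis coprime_commute prime_imp_coprime prime_nat_int_transfer)
  then obtain v where "[2 * x * v = 1] (mod int p)"
    using cong_solve_coprime_int by blast
  then obtain d where d: "2 * x * v = 1 + int p * d"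
    by (metis cong_iff_lin cong_sym)
  \<comment> \<open>Here \<open>v\<close> inverts \<open>2 * x\<close> modulo \<open>p\<close>, so
    the linear term of the shifted square cancels the error \<open>c * p ^ k\<close> up to a
    multiple of \<open>p ^ Suc k\<close>.\<close>
  let ?x = "x - c * v * int p ^ k"
  have "?x\<^sup>2 + y\<^sup>2 - t = (x\<^sup>2 + y\<^sup>2 - t) - (2 * x * v) * c * int p ^ k + (c * v)\<^sup>2 * int p ^ (k + k)"
    by (simp add: power2_eq_square power_add algebra_simps)
  also have "\<dots> = int p ^ Suc k * (- d * c) + (c * v)\<^sup>2 * int p ^ (k + k)"
    unfolding c d by (simp add: algebra_simps)
  \<comment> \<open>The quadratic term is harmless because \<open>k \<ge> 1\<close> gives
    \<open>Suc k \<le> k + k\<close>.\<close>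
  also have "int p ^ Suc k dvd \<dots>"
    using assms(3) by (intro dvd_add dvd_triv_left dvd_mult le_imp_power_dvd) simp
  finally show ?thesis by (auto simp: cong_iff_dvd_diff)
qed

lemma unit_sum_two_squares_mod_prime_power:
  fixes p k :: nat and t :: int
  assumes "prime p" "odd p" "\<not> int p dvd t" "k \<ge> 1"
  shows "\<exists>x y. [x\<^sup>2 + y\<^sup>2 = t] (mod int p ^ k)"
  using assms(4)
proof (induction k rule: dec_induct)
  case base
  show ?case using sum_two_squares_mod_prime[OF assms(1,2)] by simp
next
  case (step k)
  then obtain x y where xy: "[x\<^sup>2 + y\<^sup>2 = t] (mod int p ^ k)" by blast
  then have "[x\<^sup>2 + y\<^sup>2 = t] (mod int p)"
    using step.hyps(1) by (auto intro: cong_dvd_modulus dvd_power)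
  then have "\<not> int p dvd x\<^sup>2 + y\<^sup>2"
    using assms(3) cong_dvd_iff by blast
  \<comment> \<open>A unit sum has a unit among \<open>x\<close> and \<open>y\<close>; that one is
    the variable to lift.\<close>
  then consider "\<not> int p dvd x" | "\<not> int p dvd y"
    unfolding power2_eq_square using dvd_add dvd_mult by blast
  then show ?case
  proof cases
    case 1
    then show ?thesis
      using hensel_step_sum_two_squares[OF assms(1,2) step.hyps(1) 1 xy] by blast
  next
    case 2
    have "[y\<^sup>2 + x\<^sup>2 = t] (mod int p ^ k)" using xy by (simp add: add.commute)
    from hensel_step_sum_two_squares[OF assms(1,2) step.hyps(1) 2 this] show ?thesis
      by (metis add.commute)
  qed
qed

section \<open>Odd powers of \<open>p\<close> are excluded\<close>

text \<open>Otherwise both \<open>x\<close> and \<open>y\<close> are units; raising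
  \<open>x^2 = -y^2\<close> to the power \<open>(p - 1) / 2\<close> and applying Fermat gives
  \<open>1 = -1\<close> modulo \<open>p\<close>.\<close>

lemma prime_3_mod_4_dvd_sum_two_squares:
  fixes p :: nat and x y :: int
  assumes "prime p" "[p = 3] (mod 4)" "int p dvd x\<^sup>2 + y\<^sup>2"
  shows "int p dvd x"
proof (rule ccontr)
  assume x: "\<not> int p dvd x"
  have "int p dvd x\<^sup>2" if "int p dvd y"
    using assms(3) that by (simp add: power2_eq_square dvd_add_left_iff)
  then have y: "\<not> int p dvd y"
    using x assms(1) prime_dvd_power[of "int p" x 2] by auto
  obtain j where j: "p = 4 * j + 3"
  proof
    show "p = 4 * (p div 4) + 3"
      using assms(2) mult_div_mod_eq[of 4 p] by (simp add: cong_def)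
  qed
  \<comment> \<open>This is \<open>(p - 1) / 2\<close>; it is odd because \<open>p\<close> is 3
    modulo 4, so the minus sign survives the power.\<close>
  define q where "q = 2 * j + 1"
  have q: "p - 1 = 2 * q" "odd q" using j by (auto simp: q_def)
  have fermat: "[z ^ (p - 1) = 1] (mod int p)" if "\<not> int p dvd z" for z :: int
  proof -
    interpret residues "int p" "residue_ring (int p)"
      using prime_gt_1_nat[OF assms(1)] by unfold_locales simp_all
    have "coprime z (int p)"
      using that assms(1) by (metis coprime_commute prime_imp_coprime prime_nat_int_transfer)
    then show ?thesis
      using euler_theorem[of z] totient_prime[OF assms(1)] by simp
  qed
  have "[x\<^sup>2 = - (y\<^sup>2)] (mod int p)"
    using assms(3) by (simp add: cong_iff_dvd_diff)
  then have "[(x\<^sup>2) ^ q = (- (y\<^sup>2)) ^ q] (mod int p)" by (rule cong_pow)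
  then have "[x ^ (p - 1) = - (y ^ (p - 1))] (mod int p)"
    using q by (simp add: power_mult)
  moreover have "[- (y ^ (p - 1)) = - 1] (mod int p)"
    using fermat[OF y] by (simp add: cong_minus_minus_iff)
  ultimately have "[1 = - 1] (mod int p)"
    using fermat[OF x] by (meson cong_sym cong_trans)
  then have "int p dvd 2" by (simp add: cong_iff_dvd_diff)
  then show False using j zdvd_imp_le[of "int p" 2] by simp
qed

text \<open>Descent on \<open>s\<close>: both \<open>x\<close> and \<open>y\<close> are divisible by \<open>p\<close>, so \<open>p\<^sup>2\<close> can be cancelled.\<close>

lemma sum_two_squares_neq_odd_prime_power:
  fixes p s :: nat and x y t :: int
  assumes "prime p" "[p = 3] (mod 4)" "\<not> int p dvd t"
  shows "x\<^sup>2 + y\<^sup>2 \<noteq> t * int p ^ (2 * s + 1)"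
proof (induction s arbitrary: x y)
  case (0 x y)
  show ?case
  proof
    assume eq: "x\<^sup>2 + y\<^sup>2 = t * int p ^ (2 * 0 + 1)"
    then have "int p dvd x\<^sup>2 + y\<^sup>2" "int p dvd y\<^sup>2 + x\<^sup>2" by (simp_all add: add.commute)
    then have "int p dvd x" "int p dvd y"
      using prime_3_mod_4_dvd_sum_two_squares[OF assms(1,2)] by blast+
    \<comment> \<open>Now \<open>p^2\<close> divides \<open>t * p\<close>, which would make
      \<open>p\<close> divide \<open>t\<close>.\<close>
    then have "int p * int p dvd x\<^sup>2 + y\<^sup>2"
      unfolding power2_eq_square by (intro dvd_add mult_dvd_mono)
    then show False using eq assms(1,3) by simp
  qed
next
  case (Suc s x y)
  show ?case
  proof
    assume eq: "x\<^sup>2 + y\<^sup>2 = t * int p ^ (2 * Suc s + 1)"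
    then have "int p dvd x\<^sup>2 + y\<^sup>2" "int p dvd y\<^sup>2 + x\<^sup>2" by (simp_all add: add.commute)
    then have "int p dvd x" "int p dvd y"
      using prime_3_mod_4_dvd_sum_two_squares[OF assms(1,2)] by blast+
    then obtain x' y' where "x = int p * x'" "y = int p * y'" by (auto elim!: dvdE)
    then have "(int p)\<^sup>2 * (x'\<^sup>2 + y'\<^sup>2) = (int p)\<^sup>2 * (t * int p ^ (2 * s + 1))"
      using eq by (simp add: power2_eq_square algebra_simps)
    then have "x'\<^sup>2 + y'\<^sup>2 = t * int p ^ (2 * s + 1)"
      using assms(1) by simp
    with Suc.IH show False by blast
  qed
qed

text \<open>As \<open>k\<close> exceeds the exponent, a multiple of \<open>p ^ k\<close> only
  changes \<open>t\<close> by a multiple of \<open>p\<close>, so the congruence becomes an integer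
  equation with another unit part.\<close>

lemma sum_two_squares_not_cong_odd_prime_power:
  fixes p k s :: nat and x y t :: int
  assumes "prime p" "[p = 3] (mod 4)" "\<not> int p dvd t" "2 * s + 1 < k"
  shows "\<not> [x\<^sup>2 + y\<^sup>2 = t * int p ^ (2 * s + 1)] (mod int p ^ k)"
proof
  assume "[x\<^sup>2 + y\<^sup>2 = t * int p ^ (2 * s + 1)] (mod int p ^ k)"
  then obtain c where c: "x\<^sup>2 + y\<^sup>2 - t * int p ^ (2 * s + 1) = int p ^ k * c"
    by (auto simp: cong_iff_dvd_diff)
  obtain d where d: "k = (2 * s + 1) + Suc d"
    using less_imp_Suc_add[OF assms(4)] by auto
  have "x\<^sup>2 + y\<^sup>2 = (t + int p * (int p ^ d * c)) * int p ^ (2 * s + 1)"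
    using c unfolding d power_add by (simp add: algebra_simps)
  moreover have "\<not> int p dvd t + int p * (int p ^ d * c)"
    using assms(3) by (simp add: dvd_add_left_iff)
  ultimately show False
    using sum_two_squares_neq_odd_prime_power[OF assms(1,2)] by blast
qed

section \<open>Even powers, decomposition of residues, and the classification\<close>

text \<open>Scale both entries of a representation of \<open>t\<close> by
  \<open>p ^ s\<close>.\<close>

lemma sum_two_squares_cong_even_prime_power:
  fixes p k s :: nat and t :: int
  assumes "prime p" "odd p" "\<not> int p dvd t" "k \<ge> 1"
  shows "\<exists>x y. [t * int p ^ (2 * s) = x\<^sup>2 + y\<^sup>2] (mod int p ^ k)"
proof -
  obtain x y where "[x\<^sup>2 + y\<^sup>2 = t] (mod int p ^ k)"
    using unit_sum_two_squares_mod_prime_power[OF assms] by blast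
  then have "[(x\<^sup>2 + y\<^sup>2) * int p ^ (2 * s) = t * int p ^ (2 * s)] (mod int p ^ k)"
    by (rule cong_scalar_right)
  moreover have "(x\<^sup>2 + y\<^sup>2) * int p ^ (2 * s) = (x * int p ^ s)\<^sup>2 + (y * int p ^ s)\<^sup>2"
    by (simp add: power_mult_distrib algebra_simps flip: power_mult)
  ultimately show ?thesis by (metis cong_sym)
qed

text \<open>Take \<open>j\<close> to be the multiplicity of \<open>p\<close> in \<open>m\<close>;
  then \<open>p ^ j \<le> m < p ^ k\<close> bounds it.\<close>

lemma residue_prime_power_decomp:
  fixes p k :: nat and m :: int
  assumes "prime p" "0 < m" "m < int p ^ k"
  obtains t j where "m = t * int p ^ j" "\<not> int p dvd t" "j < k"
proof -
  obtain t where t: "m = int p ^ multiplicity (int p) m * t" "\<not> int p dvd t"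
    using assms multiplicity_decompose'[of m "int p"] by (metis less_irrefl not_prime_unit prime_nat_int_transfer)
  have "int p ^ multiplicity (int p) m dvd m" by (rule multiplicity_dvd)
  then have "int p ^ multiplicity (int p) m < int p ^ k"
    using assms(2,3) zdvd_imp_le by fastforce
  then have "multiplicity (int p) m < k"
    using assms(1) prime_gt_1_nat by (simp add: power_strict_increasing_iff)
  with t that show thesis by (metis mult.commute)
qed

text \<open>The bound \<open>2 * s + 1 < k\<close> keeps 0 out of the second family: a larger
  exponent gives the residue 0, which is a sum of two squares. In the first family large
  \<open>s\<close> only reproduces 0, which is listed anyway.\<close>

theorem theorem3:
  fixes p k :: nat
  assumes "prime p" and "[p = 3] (mod 4)" and "k \<ge> 1"
  shows "sums_two_squares_mod (p ^ k) =
           {0} \<union> {(t * int p ^ (2 * s)) mod int (p ^ k) | (s::nat) (t::int).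
                    \<not> [t = 0] (mod int p)}
       \<and> non_sums_two_squares_mod (p ^ k) =
           {(t * int p ^ (2 * s + 1)) mod int (p ^ k) | (s::nat) (t::int).
              2 * s + 1 < k \<and> \<not> [t = 0] (mod int p)}"
proof -
  define S where "S = sums_two_squares_mod (p ^ k)"
  define E where "E = {(t * int p ^ (2 * s)) mod int (p ^ k) | (s::nat) (t::int). \<not> [t = 0] (mod int p)}"
  define D where "D = {(t * int p ^ (2 * s + 1)) mod int (p ^ k) | (s::nat) (t::int).
              2 * s + 1 < k \<and> \<not> [t = 0] (mod int p)}"
  define C where "C = {0..<int (p ^ k)}"
  have p1: "p > 1" using assms(1) prime_gt_1_nat by blast
  then have n1: "p ^ k > 1" using assms(3) by (intro one_less_power) simp_all
  have "odd p"
  proof -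
    have "[p = 3] (mod 2)" using assms(2) by (rule cong_dvd_modulus_nat) simp
    then show ?thesis by (simp add: cong_def odd_iff_mod_2_eq_one)
  qed
  note S_iff = mem_sums_two_squares_mod_iff[OF n1, folded S_def]
  have car: "carrier (residue_ring (int (p ^ k))) = C"
    by (auto simp: residue_ring_def C_def)
  have mod_C: "z mod int (p ^ k) \<in> C" for z
    using p1 by (simp add: C_def)
  have "S \<subseteq> C" by (auto simp: S_iff C_def)
  have "0 \<in> S"
    unfolding S_iff using p1 by (auto intro!: exI[of _ 0])
  have "E \<subseteq> S"
  proof
    fix m assume "m \<in> E"
    then obtain s t where m: "m = (t * int p ^ (2 * s)) mod int (p ^ k)" and t: "\<not> int p dvd t"
      by (auto simp: E_def cong_0_iff)
    obtain x y where "[t * int p ^ (2 * s) = x\<^sup>2 + y\<^sup>2] (mod int (p ^ k))"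
      using sum_two_squares_cong_even_prime_power[OF assms(1) \<open>odd p\<close> t assms(3), of s] by auto
    then have "[m = x\<^sup>2 + y\<^sup>2] (mod int (p ^ k))" by (simp add: m cong_def)
    then show "m \<in> S" using mod_C m by (auto simp: S_iff C_def)
  qed
  have "D \<inter> S = {}"
  proof -
    have "m \<notin> S" if "m \<in> D" for m
    proof
      assume "m \<in> S"
      then obtain x y where xy: "[m = x\<^sup>2 + y\<^sup>2] (mod int (p ^ k))" by (auto simp: S_iff)
      obtain s t where m: "m = (t * int p ^ (2 * s + 1)) mod int (p ^ k)"
        and st: "\<not> int p dvd t" "2 * s + 1 < k"
        using \<open>m \<in> D\<close> unfolding D_def cong_0_iff by blast
      have "[x\<^sup>2 + y\<^sup>2 = t * int p ^ (2 * s + 1)] (mod int p ^ k)"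
        using xy unfolding m by (simp add: cong_def)
      with sum_two_squares_not_cong_odd_prime_power[OF assms(1,2) st] show False by blast
    qed
    then show ?thesis by blast
  qed
  have "C \<subseteq> {0} \<union> E \<union> D"
  proof
    fix m assume m: "m \<in> C"
    show "m \<in> {0} \<union> E \<union> D"
    proof (cases "m = 0")
      case False
      then obtain t j where tj: "m = t * int p ^ j" "\<not> int p dvd t" "j < k"
        using residue_prime_power_decomp[OF assms(1), of m k] m by (auto simp: C_def)
      have mm: "m = (t * int p ^ j) mod int (p ^ k)"
        using m tj(1) by (simp add: C_def)
      show ?thesis
      proof (cases "even j")
        case True
        then obtain s where "j = 2 * s" by (elim evenE)
        then have "m \<in> E" unfolding E_def cong_0_iff using mm tj by blast
        then show ?thesis by blast
      next
        case False
        then obtain s where "j = 2 * s + 1" by (elim oddE)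
        then have "m \<in> D" unfolding D_def cong_0_iff using mm tj by blast
        then show ?thesis by blast
      qed
    qed simp
  qed
  have "D \<subseteq> C" using mod_C by (auto simp: D_def)
  \<comment> \<open>The sets \<open>{0}\<close>, \<open>E\<close> and \<open>D\<close> cover
    \<open>C\<close>; the first two lie in \<open>S\<close> and \<open>D\<close> misses it, which
    settles both equalities.\<close>
  have "S = {0} \<union> E"
    using \<open>S \<subseteq> C\<close> \<open>0 \<in> S\<close> \<open>E \<subseteq> S\<close> \<open>D \<inter> S = {}\<close> \<open>C \<subseteq> {0} \<union> E \<union> D\<close> by blast
  moreover have "C - S = D"
    using \<open>D \<subseteq> C\<close> \<open>0 \<in> S\<close> \<open>E \<subseteq> S\<close> \<open>D \<inter> S = {}\<close> \<open>C \<subseteq> {0} \<union> E \<union> D\<close> by blast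
  ultimately show ?thesis
    unfolding non_sums_two_squares_mod_def car
    unfolding S_def E_def D_def by blast
qed

end
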